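(* Let $q\ge 2$ be a prime power and let $V$ be an $n$-dimensional vector space over $\mathbb{F}_q$. Let $n,k,t,s$ be positive integers with $k\ge t+1$ and $n\ge 2k+2t+1+\log_q(7s)$. If $\mathcal{F},\mathcal{G}\subseteq {V\brack k}$ are $s$-almost cross-$t$-intersecting families, then $$|\mathcal{F}||\mathcal{G}|\le {n-t\brack k-t}^2.$$ Equality holds if and only if $\mathcal{F}=\mathcal{G}=\{H\in {V\brack k}: E\subseteq H\}$ for some $E\in{V\brack t}$.
   Context: ${V\brack k}$ denotes the set of all $k$-dimensional subspaces of $V$. The Gaussian binomial coefficient is ${a\brack b}=\prod_{0\le i<b}\frac{q^{a-i}-1}{q^{b-i}-1}$ for positive integers $a,b$, with ${a\brack 0}=1$ and ${a\brack b}=0$ for negative $b$. For a family $\mathcal{G}\subseteq{V\brack k}$ and a subspace $F$, let $\mathcal{D}_{\mathcal{G}}(F;t)=\{G\in\mathcal{G}:\dim(G\cap F)<t\}$. Two families $\mathcal{F},\mathcal{G}\subseteq{V\brack k}$ are $s$-almost cross-$t$-intersecting if $|\mathcal{D}_{\mathcal{G}}(F;t)|\le s$ for every $F\in\mathcal{F}$ and $|\mathcal{D}_{\mathcal{F}}(G;t)|\le s$ for every $G\in\mathcal{G}$. *)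

theory Defs
  imports Complex_Main "HOL-Library.Cardinality"
begin

definition subspaces_of_dim ::
  "('a::field \<Rightarrow> 'b::ab_group_add \<Rightarrow> 'b) \<Rightarrow> nat \<Rightarrow> 'b set set" where
  "subspaces_of_dim scale k =
     {W. module.subspace scale W \<and> vector_space.dim scale W = k}"

text \<open>The arguments are natural numbers, so the convention that the coefficient vanishes for
  negative \<open>b\<close> does not arise.  For \<open>a < b\<close> the truncated subtraction \<open>a - i\<close> is harmless, because
  the factor at \<open>i = a\<close> is \<open>0\<close>; for \<open>b = 0\<close> the product is empty.\<close>

definition gauss_binomial :: "nat \<Rightarrow> nat \<Rightarrow> nat \<Rightarrow> real" where
  "gauss_binomial q a b =
     (\<Prod>i<b. (real q ^ (a - i) - 1) / (real q ^ (b - i) - 1))"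

definition deficient ::
  "('a::field \<Rightarrow> 'b::ab_group_add \<Rightarrow> 'b) \<Rightarrow> 'b set set \<Rightarrow> 'b set \<Rightarrow> nat \<Rightarrow> 'b set set" where
  "deficient scale \<G> F t = {G \<in> \<G>. vector_space.dim scale (G \<inter> F) < t}"

definition almost_cross_intersecting ::
  "('a::field \<Rightarrow> 'b::ab_group_add \<Rightarrow> 'b) \<Rightarrow> nat \<Rightarrow> nat \<Rightarrow> 'b set set \<Rightarrow> 'b set set \<Rightarrow> bool" where
  "almost_cross_intersecting scale s t \<F> \<G> \<longleftrightarrow>
     (\<forall>F\<in>\<F>. card (deficient scale \<G> F t) \<le> s) \<and>
     (\<forall>G\<in>\<G>. card (deficient scale \<F> G t) \<le> s)"

end

theory Submission
  imports Defs
begin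

text \<open>
  Call a subspace \<open>W\<close> an almost cover of a family if all but at most \<open>s\<close> of its members meet \<open>W\<close> in
  dimension at least \<open>t\<close>, and let \<open>t + a\<close> and \<open>t + b\<close> be the least dimensions \<open>\<ge> t\<close> of almost covers
  of \<open>\<F>\<close> and \<open>\<G>\<close>.  If \<open>dim W < t + a\<close>, some \<open>F \<in> \<F>\<close> has \<open>dim (F \<inter> W) < t\<close>, so all but \<open>s\<close> of the
  members of \<open>\<G>\<close> through \<open>W\<close> pass through one of at most \<open>q\<^sup>k\<close> subspaces \<open>\<langle>W, y\<rangle>\<close> with \<open>y \<in> F - W\<close>.
  Iterating from dimension \<open>t\<close> up to \<open>t + a\<close>, a \<open>t\<close>-space lies in at most \<open>(7q\<^bsup>2t\<^esup>)\<^bsup>-a\<^esup> M\<close> members of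
  \<open>\<G>\<close>, where \<open>M\<close> is the Gaussian binomial coefficient of \<open>n - t\<close> over \<open>k - t\<close>.  An almost cover of \<open>\<G>\<close>
  of dimension \<open>t + b\<close> contains at most \<open>q\<^bsup>2tb\<^esup>\<close> such \<open>t\<close>-spaces.  In the product of this bound on
  \<open>|\<G>|\<close> with the symmetric bound on \<open>|\<F>|\<close> the powers of \<open>q\<close> cancel, leaving at most
  \<open>(9/4) 7\<^bsup>-(a+b)\<^esup> M\<^sup>2\<close>.  This is below \<open>M\<^sup>2\<close> unless \<open>a = b = 0\<close>, when \<open>\<F>\<close> and \<open>\<G>\<close> are almost
  contained in stars of \<open>t\<close>-spaces; a member outside the opposite star makes the product small.
\<close>

section \<open>Gaussian binomial coefficients\<close>

lemma gauss_binomial_0 [simp]: "gauss_binomial q a 0 = 1"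
  by (simp add: gauss_binomial_def)

lemma gauss_binomial_Suc:
  "gauss_binomial q a (Suc b) =
     (real q ^ a - 1) / (real q ^ Suc b - 1) * gauss_binomial q (a - 1) b"
proof -
  have "(\<Prod>i<b. (real q ^ (a - Suc i) - 1) / (real q ^ (Suc b - Suc i) - 1)) = gauss_binomial q (a - 1) b"
    unfolding gauss_binomial_def by simp
  then show ?thesis
    unfolding gauss_binomial_def prod.lessThan_Suc_shift by simp
qed

lemma gauss_binomial_nonneg: "q \<ge> 2 \<Longrightarrow> gauss_binomial q a b \<ge> 0"
  unfolding gauss_binomial_def by (intro prod_nonneg ballI divide_nonneg_nonneg) simp_all

text \<open>The factor split off by \<open>gauss_binomial_Suc\<close> is at least q^c. This gives
  both the power lower bound and the decay of \<open>N\<close>.\<close>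

lemma gauss_binomial_add_Suc_ge:
  assumes "q \<ge> 2"
  shows "real q ^ c * gauss_binomial q (c + b) b \<le> gauss_binomial q (c + Suc b) (Suc b)"
proof -
  have *: "real q ^ Suc b - 1 > 0" using assms one_less_power[of "real q" "Suc b"] by simp
  have "real q ^ c * (real q ^ Suc b - 1) \<le> real q ^ (c + Suc b) - 1"
    using assms by (simp add: power_add algebra_simps)
  then have 1: "real q ^ c \<le> (real q ^ (c + Suc b) - 1) / (real q ^ Suc b - 1)"
    using * by (simp add: pos_le_divide_eq)
  have "real q ^ c * gauss_binomial q (c + b) b
      \<le> (real q ^ (c + Suc b) - 1) / (real q ^ Suc b - 1) * gauss_binomial q (c + b) b"
    by (rule mult_right_mono[OF 1 gauss_binomial_nonneg[OF assms]])
  then show ?thesis unfolding gauss_binomial_Suc by simp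
qed

lemma gauss_binomial_ge_power:
  assumes "q \<ge> 2"
  shows "real q ^ (c * b) \<le> gauss_binomial q (c + b) b"
proof (induction b)
  case (Suc b)
  have "real q ^ (c * Suc b) = real q ^ c * real q ^ (c * b)" by (simp add: power_add)
  also have "\<dots> \<le> real q ^ c * gauss_binomial q (c + b) b" using Suc by (intro mult_left_mono) auto
  also have "\<dots> \<le> gauss_binomial q (c + Suc b) (Suc b)" by (rule gauss_binomial_add_Suc_ge[OF assms])
  finally show ?case .
qed simp

text \<open>The factor split off is at most q^(2c): for c > 0 by q^(c+1) <= q^(2c) and q^b <=
  q^(b+1) - 1, and for c = 0 it is 1. The doubled exponent buys a pure power of q, which later
  cancels against \<open>v\<close>.\<close>

lemma gauss_binomial_le_power:
  assumes "q \<ge> 2"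
  shows "gauss_binomial q (c + b) b \<le> real q ^ (2 * b * c)"
proof (induction b)
  case (Suc b)
  have *: "real q ^ Suc b - 1 > 0" using assms one_less_power[of "real q" "Suc b"] by simp
  have "real q ^ (c + Suc b) - 1 \<le> real q ^ (2 * c) * (real q ^ Suc b - 1)"
  proof (cases "c = 0")
    case False
    have "real q ^ b * 1 \<le> real q ^ b * (real q - 1)"
      using assms by (intro mult_left_mono) auto
    then have "real q ^ b \<le> real q ^ Suc b - real q ^ b" by (simp add: algebra_simps)
    also have "\<dots> \<le> real q ^ Suc b - 1" using assms by simp
    finally have 1: "real q ^ b \<le> real q ^ Suc b - 1" .
    have "real q ^ (c + Suc b) = real q ^ Suc c * real q ^ b" by (simp add: power_add)
    also have "\<dots> \<le> real q ^ (2 * c) * (real q ^ Suc b - 1)"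
      using False assms 1 by (intro mult_mono power_increasing) auto
    finally show ?thesis by simp
  qed simp
  then have 2: "(real q ^ (c + Suc b) - 1) / (real q ^ Suc b - 1) \<le> real q ^ (2 * c)"
    using * by (simp add: pos_divide_le_eq)
  have "gauss_binomial q (c + Suc b) (Suc b) \<le> real q ^ (2 * c) * real q ^ (2 * b * c)"
    unfolding gauss_binomial_Suc using Suc gauss_binomial_nonneg[OF assms] 2
    by (intro mult_mono) auto
  also have "\<dots> = real q ^ (2 * Suc b * c)" by (simp add: power_add algebra_simps)
  finally show ?case .
qed simp

section \<open>Counting subspaces\<close>

locale finite_field_space = finite_dimensional_vector_space scale Basis
  for scale :: "'a::{field,finite} \<Rightarrow> 'b::ab_group_add \<Rightarrow> 'b" and Basis
begin

text \<open>Adjoining \<open>a\<close> multiplies the size by that of the field, since by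
  independence \<open>(c, y)\<close> maps injectively to \<open>scale c a + y\<close>.\<close>

lemma card_span_independent:
  assumes "finite B" "independent B"
  shows "finite (span B) \<and> card (span B) = CARD('a) ^ card B"
  using assms
proof (induction B rule: finite_induct)
  case (insert a B)
  then have ind: "independent B" and a: "a \<notin> span B"
    by (auto simp: independent_insert)
  let ?f = "\<lambda>(c, y). scale c a + y"
  have img: "span (insert a B) = ?f ` (UNIV \<times> span B)"
  proof (intro equalityI subsetI)
    fix x assume "x \<in> span (insert a B)"
    then obtain c where "x - scale c a \<in> span B" by (auto simp: span_insert)
    then show "x \<in> ?f ` (UNIV \<times> span B)"
      by (intro image_eqI[of _ _ "(c, x - scale c a)"]) auto
  next
    fix x assume "x \<in> ?f ` (UNIV \<times> span B)"
    then obtain c y where "x = scale c a + y" "y \<in> span B" by auto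
    then have "x - scale c a \<in> span B" by simp
    then show "x \<in> span (insert a B)" by (auto simp: span_insert)
  qed
  have "inj_on ?f (UNIV \<times> span B)"
  proof (rule inj_onI, clarify)
    fix c d y z assume y: "y \<in> span B" and z: "z \<in> span B" and eq: "scale c a + y = scale d a + z"
    have "scale (c - d) a = z - y" using eq by (simp add: scale_left_diff_distrib algebra_simps)
    then have "scale (c - d) a \<in> span B" using y z span_diff by simp
    then have "c = d"
      using a span_scale[of "scale (c - d) a" B "inverse (c - d)"] by (cases "c = d") auto
    then show "c = d \<and> y = z" using eq by simp
  qed
  with insert ind show ?case unfolding img
    by (simp add: card_image card_cartesian_product)
qed simp

lemma finite_UNIV_space: "finite (UNIV :: 'b set)"
  using card_span_independent[OF finite_Basis independent_Basis] span_Basis by simp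

lemma finite_space [simp]: "finite (S :: 'b set)"
  using finite_UNIV_space by (rule rev_finite_subset) simp

lemma finite_space_sets [simp]: "finite (S :: 'b set set)"
  by (rule finite_subset[OF _ finite_Pow_iff[THEN iffD2, OF finite_UNIV_space]]) simp

lemma card_subspace:
  assumes "subspace S"
  shows "card S = CARD('a) ^ dim S"
proof -
  obtain B where B: "B \<subseteq> S" "independent B" "S \<subseteq> span B" "card B = dim S"
    using basis_exists by blast
  then have "span B = S" using assms span_minimal by blast
  then show ?thesis using card_span_independent[of B] B by simp
qed

lemma CARD_ge_2: "CARD('a) \<ge> 2"
proof -
  have "card {0::'a, 1} \<le> CARD('a)" by (rule card_mono) auto
  then show ?thesis by simp
qed

section \<open>Subspaces between two given ones\<close>

lemma subspaces_of_dim_iff: "H \<in> subspaces_of_dim scale k \<longleftrightarrow> subspace H \<and> dim H = k"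
  by (simp add: subspaces_of_dim_def)

lemma dim_span_insert:
  assumes "subspace W" "y \<notin> W"
  shows "dim (span (insert y W)) = Suc (dim W)"
proof -
  have "y \<notin> span W" using assms span_eq_iff[of W] by blast
  then show ?thesis using dim_insert[of y W] by simp
qed

text \<open>\<open>U = UNIV\<close> gives the k-spaces through \<open>W\<close>, and
  \<open>W = {0}\<close> those inside \<open>U\<close>; the lower end varies in the induction of
  \<open>card_between\<close>.\<close>

definition between :: "nat \<Rightarrow> 'b set \<Rightarrow> 'b set \<Rightarrow> 'b set set" where
  "between k W U = {H \<in> subspaces_of_dim scale k. W \<subseteq> H \<and> H \<subseteq> U}"

lemma between_span_insert:
  "{H \<in> between k W U. y \<in> H} = between k (span (insert y W)) U"
proof -
  have "span (insert y W) \<subseteq> H \<longleftrightarrow> y \<in> H \<and> W \<subseteq> H" if "subspace H" for H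
    using that span_minimal[of "insert y W" H] span_superset[of "insert y W"] by blast
  then show ?thesis by (auto simp: between_def subspaces_of_dim_iff)
qed

text \<open>Pairs \<open>(H, y)\<close> with \<open>y \<in> H - W\<close> are counted by
  \<open>H\<close> and by \<open>y\<close>.\<close>

lemma card_between_double_count:
  assumes "subspace W"
  shows "(\<Sum>H\<in>between k W U. card (H - W)) = (\<Sum>y\<in>U - W. card (between k (span (insert y W)) U))"
proof -
  have "(\<Sum>H\<in>between k W U. card (H - W)) = (\<Sum>H\<in>between k W U. \<Sum>y\<in>U - W. of_bool (y \<in> H))"
  proof (rule sum.cong)
    fix H assume "H \<in> between k W U"
    then have "{y \<in> U - W. y \<in> H} = H - W" by (auto simp: between_def)
    moreover have "(\<Sum>y\<in>U - W. of_bool (y \<in> H)) = card {y \<in> U - W. y \<in> H}"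
      by (simp add: sum_of_bool_eq Int_def)
    ultimately show "card (H - W) = (\<Sum>y\<in>U - W. of_bool (y \<in> H))" by simp
  qed simp
  also have "\<dots> = (\<Sum>y\<in>U - W. \<Sum>H\<in>between k W U. of_bool (y \<in> H))" by (rule sum.swap)
  also have "\<dots> = (\<Sum>y\<in>U - W. card {H \<in> between k W U. y \<in> H})"
    by (simp add: sum_of_bool_eq Int_def)
  finally show ?thesis by (simp only: between_span_insert)
qed

text \<open>Let i = dim W. Each \<open>H\<close> has q^k - q^i vectors outside \<open>W\<close>, and
  each \<open>y\<close> in \<open>U - W\<close> raises the lower end to dimension i + 1, where the
  induction hypothesis applies. Cancelling q^i leaves the recursion
  \<open>gauss_binomial_Suc\<close>. For k > dim U both sides vanish.\<close>

theorem card_between: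
  assumes "subspace W" "subspace U" "W \<subseteq> U" "dim W \<le> k"
  shows "real (card (between k W U)) = gauss_binomial (CARD('a)) (dim U - dim W) (k - dim W)"
  using assms
proof (induction "k - dim W" arbitrary: W)
  case 0
  have "between k W U = {W}"
  proof (intro equalityI subsetI)
    fix H assume "H \<in> between k W U"
    then show "H \<in> {W}"
      using 0 subspace_dim_equal[of W H] by (simp add: between_def subspaces_of_dim_iff)
  qed (use 0 in \<open>auto simp: between_def subspaces_of_dim_iff\<close>)
  then show ?case using 0 by simp
next
  case (Suc b)
  let ?q = "real (CARD('a))"
  let ?i = "dim W" and ?N = "dim U"
  have q: "?q > 1" using CARD_ge_2 by linarith
  have iN: "?i \<le> ?N" using Suc.prems dim_subset by blast
  have ik: "?i < k" using Suc by linarith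
  have sub: "card (H - W) = card H - card W" if "W \<subseteq> H" for H
    using that by (simp add: card_Diff_subset)
  have cW: "card W = CARD('a) ^ ?i" using Suc.prems card_subspace by blast
  have 1: "card (H - W) = CARD('a) ^ k - CARD('a) ^ ?i" if "H \<in> between k W U" for H
    using that cW card_subspace sub by (auto simp: between_def subspaces_of_dim_iff)
  have 2: "real (card (between k (span (insert y W)) U)) = gauss_binomial (CARD('a)) (?N - ?i - 1) b"
    if "y \<in> U - W" for y
  proof -
    have d: "dim (span (insert y W)) = Suc ?i" using dim_span_insert Suc.prems that by simp
    have "b = k - dim (span (insert y W))" using d Suc.hyps by simp
    moreover have "span (insert y W) \<subseteq> U" using that Suc.prems by (intro span_minimal) auto
    ultimately show ?thesis using Suc.hyps(1)[of "span (insert y W)"] Suc.prems ik d by simp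
  qed
  have "real (card (between k W U)) * (?q ^ k - ?q ^ ?i) = real (\<Sum>H\<in>between k W U. card (H - W))"
    using 1 ik CARD_ge_2 by (simp add: of_nat_diff power_increasing)
  also have "\<dots> = (\<Sum>y\<in>U - W. real (card (between k (span (insert y W)) U)))"
    using card_between_double_count[OF Suc.prems(1)] by simp
  also have "\<dots> = real (card (U - W)) * gauss_binomial (CARD('a)) (?N - ?i - 1) b"
    using 2 by simp
  also have "real (card (U - W)) = ?q ^ ?N - ?q ^ ?i"
    using sub[OF Suc.prems(3)] card_subspace[OF Suc.prems(2)] cW iN CARD_ge_2
    by (simp add: of_nat_diff power_increasing)
  finally have A: "real (card (between k W U)) * (?q ^ k - ?q ^ ?i) =
      (?q ^ ?N - ?q ^ ?i) * gauss_binomial (CARD('a)) (?N - ?i - 1) b" .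
  have B: "?q ^ m - ?q ^ ?i = ?q ^ ?i * (?q ^ (m - ?i) - 1)" if "?i \<le> m" for m
    using that by (simp add: algebra_simps flip: power_add)
  have C: "?q ^ (k - ?i) - 1 > 0" using q ik one_less_power[of ?q "k - ?i"] by simp
  have "?q ^ ?i * (real (card (between k W U)) * (?q ^ (k - ?i) - 1)) =
      ?q ^ ?i * ((?q ^ (?N - ?i) - 1) * gauss_binomial (CARD('a)) (?N - ?i - 1) b)"
    using A unfolding B[OF iN] B[OF less_imp_le[OF ik]] by (simp add: mult_ac)
  then have "real (card (between k W U)) * (?q ^ (k - ?i) - 1) =
      (?q ^ (?N - ?i) - 1) * gauss_binomial (CARD('a)) (?N - ?i - 1) b"
    using q by simp
  then have "real (card (between k W U)) =
      (?q ^ (?N - ?i) - 1) / (?q ^ Suc b - 1) * gauss_binomial (CARD('a)) (?N - ?i - 1) b"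
    using C Suc.hyps(2) by (simp add: field_simps)
  then show ?case using Suc.hyps(2) gauss_binomial_Suc by metis
qed

section \<open>Intersections of dimension t and branching\<close>

lemma subspace_of_dim_exists:
  assumes "subspace S" "t \<le> dim S"
  obtains T where "subspace T" "dim T = t" "T \<subseteq> S"
proof -
  obtain B where B: "B \<subseteq> S" "independent B" "S \<subseteq> span B" "card B = dim S"
    using basis_exists by blast
  obtain C where C: "C \<subseteq> B" "card C = t"
    using obtain_subset_with_card_n assms(2) B(4) by metis
  have "dim (span C) = t"
    using C B independent_mono dim_span_eq_card_independent by metis
  moreover have "span C \<subseteq> S" using C B assms by (intro span_minimal) auto
  ultimately show thesis using that[OF subspace_span] by blast
qed

text \<open>A proper subspace has smaller dimension, so the members deficient with a t-space are
  exactly those outside its star.\<close>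

lemma dim_Int_less_iff:
  assumes "subspace W" "dim W = t" "subspace F"
  shows "dim (F \<inter> W) < t \<longleftrightarrow> \<not> W \<subseteq> F"
proof
  assume "\<not> W \<subseteq> F"
  then have "F \<inter> W \<noteq> W" by blast
  then have "\<not> dim W \<le> dim (F \<inter> W)"
    using subspace_dim_equal[of "F \<inter> W" W] subspace_inter assms by auto
  then show "dim (F \<inter> W) < t" using assms by simp
next
  assume "dim (F \<inter> W) < t"
  then show "\<not> W \<subseteq> F" using assms by (auto simp: Int_absorb1)
qed

text \<open>Every member of \<open>\<G>\<close> through \<open>W\<close> that meets \<open>F\<close> in dimension at least \<open>t\<close> contains a point
  of \<open>F\<close> outside \<open>W\<close>.\<close>

lemma card_star_branch:
  assumes G: "\<G> \<subseteq> subspaces_of_dim scale k"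
    and F: "F \<in> subspaces_of_dim scale k" "dim (F \<inter> W) < t"
    and d: "card (deficient scale \<G> F t) \<le> s"
    and W: "subspace W" and "g \<ge> 0"
    and g: "\<And>W1. subspace W1 \<Longrightarrow> dim W1 = Suc (dim W) \<Longrightarrow> real (card {G \<in> \<G>. W1 \<subseteq> G}) \<le> g"
  shows "real (card {G \<in> \<G>. W \<subseteq> G}) \<le> real s + real (CARD('a)) ^ k * g"
proof -
  let ?S = "\<lambda>y. {G \<in> \<G>. span (insert y W) \<subseteq> G}"
  have "{G \<in> \<G>. W \<subseteq> G} \<subseteq> deficient scale \<G> F t \<union> (\<Union>y\<in>F - W. ?S y)"
  proof
    fix G assume *: "G \<in> {G \<in> \<G>. W \<subseteq> G}"
    then have sG: "subspace G" using G subspaces_of_dim_iff by auto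
    show "G \<in> deficient scale \<G> F t \<union> (\<Union>y\<in>F - W. ?S y)"
    proof (cases "dim (G \<inter> F) < t")
      case True
      then show ?thesis using * by (simp add: deficient_def)
    next
      case False
      then have "\<not> G \<inter> F \<subseteq> F \<inter> W" using F(2) dim_subset[of "G \<inter> F" "F \<inter> W"] by linarith
      then obtain y where y: "y \<in> G" "y \<in> F" "y \<notin> W" by blast
      then have "span (insert y W) \<subseteq> G" using * sG by (intro span_minimal) auto
      then show ?thesis using y * by auto
    qed
  qed
  then have "card {G \<in> \<G>. W \<subseteq> G} \<le> card (deficient scale \<G> F t \<union> (\<Union>y\<in>F - W. ?S y))"
    by (intro card_mono) auto
  also have "\<dots> \<le> card (deficient scale \<G> F t) + card (\<Union>y\<in>F - W. ?S y)" by (rule card_Un_le)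
  also have "\<dots> \<le> s + (\<Sum>y\<in>F - W. card (?S y))"
    by (intro add_mono d card_UN_le) simp
  finally have "real (card {G \<in> \<G>. W \<subseteq> G}) \<le> real (s + (\<Sum>y\<in>F - W. card (?S y)))"
    by (simp only: of_nat_le_iff)
  also have "\<dots> = real s + (\<Sum>y\<in>F - W. real (card (?S y)))" by simp
  also have "(\<Sum>y\<in>F - W. real (card (?S y))) \<le> (\<Sum>y\<in>F - W. g)"
    by (intro sum_mono g) (use dim_span_insert[OF W] in auto)
  \<comment> \<open>Counting vectors \<open>y\<close> rather than the extensions of \<open>W\<close>
    they span overcounts, but gives the simple factor q^k.\<close>
  also have "(\<Sum>y\<in>F - W. g) \<le> real (CARD('a)) ^ k * g"
  proof -
    have "card (F - W) \<le> card F" by (intro card_mono) auto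
    also have "\<dots> = CARD('a) ^ k" using F(1) card_subspace subspaces_of_dim_iff by auto
    finally have "real (card (F - W)) \<le> real (CARD('a)) ^ k" by (metis of_nat_le_iff of_nat_power)
    then show ?thesis using \<open>g \<ge> 0\<close> by (simp add: mult_right_mono)
  qed
  finally show ?thesis by simp
qed

end

section \<open>Almost cross-intersecting families\<close>

text \<open>\<open>large\<close> is the hypothesis on n with its logarithm exponentiated.\<close>

locale large_space = finite_field_space scale Basis
  for scale :: "'a::{field,finite} \<Rightarrow> 'b::ab_group_add \<Rightarrow> 'b" and Basis +
  fixes q n k t s :: nat
  assumes CARD_eq_q: "CARD('a) = q"
    and dim_UNIV_n: "dim (UNIV :: 'b set) = n"
    and t_less_k: "t < k"
    and s_pos: "s > 0"
    and large: "7 * s * q ^ (2 * k + 2 * t + 1) \<le> q ^ n"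
begin

text \<open>The size of the full star of an i-space, for i <= k (\<open>card_star\<close>);
  \<open>N t\<close> is the M of the overview.\<close>

definition N where "N i = gauss_binomial q (n - i) (k - i)"
text \<open>The gain per dimension of a cover number: q^(2t) matches the bound q^(2tb) on the
  t-spaces in a cover, and 7 outweighs constants such as 9/4.\<close>

definition v where "v = 1 / (7 * real q ^ (2 * t))"

section \<open>Numerical consequences of the lower bound on n\<close>

lemma q_ge_2_nat: "q \<ge> 2"
  using CARD_ge_2 CARD_eq_q by simp

lemma q_ge_2: "real q \<ge> 2"
  using q_ge_2_nat by linarith

lemma k_le_n: "k \<le> n"
proof -
  have "1 * q ^ (2 * k + 2 * t + 1) \<le> 7 * s * q ^ (2 * k + 2 * t + 1)"
    using s_pos by (intro mult_right_mono) auto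
  then have "q ^ (2 * k + 2 * t + 1) \<le> q ^ n" using large by (simp only: mult_1)
  moreover have "1 < q" using q_ge_2_nat by simp
  ultimately have "2 * k + 2 * t + 1 \<le> n" by (rule power_le_imp_le_exp[rotated])
  then show ?thesis by simp
qed

lemma v_pos: "v > 0"
  using q_ge_2 by (simp add: v_def)

lemma v_le: "v \<le> 1 / 7"
  using q_ge_2 by (simp add: v_def field_simps)

lemma N_nonneg: "N i \<ge> 0"
  using gauss_binomial_nonneg[OF q_ge_2_nat] by (simp add: N_def)

text \<open>Dividing \<open>large\<close> by q^k leaves 7 s q q^k q^(2t) <= q^(n-k). The single q,
  from the \<open>+ 1\<close> in the exponent, is used as q >= 2 and pays for the 2.\<close>

lemma v_gap: "2 * real s * real q ^ k \<le> v * real q ^ (n - k)"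
proof -
  have "real (7 * s * q ^ (2 * k + 2 * t + 1)) \<le> real (q ^ n)"
    using large of_nat_le_iff by blast
  then have "7 * real s * real q ^ (2 * k + 2 * t + 1) \<le> real q ^ n" by simp
  moreover have "real q ^ n = real q ^ (n - k) * real q ^ k" using k_le_n by (simp flip: power_add)
  moreover have "real q ^ (2 * k + 2 * t + 1) = real q * real q ^ k * real q ^ (2 * t) * real q ^ k"
    unfolding mult_2 by (simp add: power_add mult_ac)
  ultimately have "(7 * real s * real q * real q ^ k * real q ^ (2 * t)) * real q ^ k \<le> real q ^ (n - k) * real q ^ k"
    by (simp only: mult.assoc)
  then have 1: "7 * real s * real q * real q ^ k * real q ^ (2 * t) \<le> real q ^ (n - k)"
    by (rule mult_right_le_imp_le) (use q_ge_2 in simp)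
  have "2 * (7 * real s * real q ^ k * real q ^ (2 * t)) \<le> real q * (7 * real s * real q ^ k * real q ^ (2 * t))"
    using q_ge_2 by (intro mult_right_mono) auto
  then have "2 * real s * real q ^ k * (7 * real q ^ (2 * t)) \<le> real q ^ (n - k)" using 1 by (simp add: mult_ac)
  then show ?thesis using q_ge_2 by (simp add: v_def pos_le_divide_eq)
qed

text \<open>One more dimension divides \<open>N\<close> by at least q^(n-k), which by
  \<open>v_gap\<close> outweighs the q^k branches of \<open>card_star_branch\<close>. Spending only
  v/2 leaves room for the s exceptions.\<close>

lemma N_Suc_le:
  assumes "i < k"
  shows "real q ^ k * N (Suc i) \<le> v / 2 * N i"
proof -
  have "n - i = (n - k) + Suc (k - Suc i)" "n - Suc i = (n - k) + (k - Suc i)" "k - i = Suc (k - Suc i)"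
    using assms k_le_n by linarith+
  then have 1: "real q ^ (n - k) * N (Suc i) \<le> N i"
    unfolding N_def using gauss_binomial_add_Suc_ge[OF q_ge_2_nat, of "n - k" "k - Suc i"] by metis
  have "2 * real q ^ k * 1 \<le> 2 * real q ^ k * real s" using s_pos by (intro mult_left_mono) auto
  also have "\<dots> \<le> v * real q ^ (n - k)" using v_gap by (simp add: mult_ac)
  finally have "2 * real q ^ k * N (Suc i) \<le> v * real q ^ (n - k) * N (Suc i)"
    using N_nonneg by (intro mult_right_mono) auto
  also have "\<dots> \<le> v * N i" using 1 v_pos by (simp add: mult.assoc mult_left_mono)
  finally show ?thesis by simp
qed

text \<open>This lets s exceptions fit into half of a bound v^a N i. By \<open>v_gap\<close>, 2s <=
  v q^(n-k); the right side is at least 1, hence at most its (k-i)-th power, and q^((n-k)(k-i)) <= N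
  i.\<close>

lemma N_ge:
  assumes "i < k" "a \<le> k - i"
  shows "2 * real s \<le> v ^ a * N i"
proof -
  have q1: "1 \<le> real q ^ k" using q_ge_2 by simp
  have "2 * real s * 1 \<le> 2 * real s * real q ^ k" using q1 by (intro mult_left_mono) auto
  then have 1: "2 * real s \<le> v * real q ^ (n - k)" using v_gap by simp
  then have "1 \<le> v * real q ^ (n - k)" using s_pos by linarith
  then have "v * real q ^ (n - k) \<le> (v * real q ^ (n - k)) ^ (k - i)"
    using assms power_increasing[of 1 "k - i" "v * real q ^ (n - k)"] by simp
  also have "\<dots> = v ^ (k - i) * real q ^ ((n - k) * (k - i))" by (simp add: power_mult_distrib power_mult)
  also have "\<dots> \<le> v ^ a * N i"
  proof (rule mult_mono)
    show "v ^ (k - i) \<le> v ^ a" using assms v_pos v_le by (intro power_decreasing) auto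
    have "n - i = (n - k) + (k - i)" using assms k_le_n by linarith
    then show "real q ^ ((n - k) * (k - i)) \<le> N i"
      unfolding N_def using gauss_binomial_ge_power[OF q_ge_2_nat, of "n - k" "k - i"] by metis
  qed (use v_pos q_ge_2 in auto)
  finally show ?thesis using 1 by linarith
qed

lemma N_t_pos: "N t > 0"
  using N_ge[of t 0] t_less_k s_pos by simp

section \<open>Stars and almost covers\<close>

lemma card_star:
  assumes "subspace W" "dim W \<le> k"
  shows "real (card {H \<in> subspaces_of_dim scale k. W \<subseteq> H}) = N (dim W)"
  using card_between[of W UNIV k, unfolded CARD_eq_q] assms dim_UNIV_n by (simp add: between_def N_def)

lemma card_substar_le:
  assumes "\<G> \<subseteq> subspaces_of_dim scale k" "subspace W" "dim W \<le> k"
  shows "real (card {G \<in> \<G>. W \<subseteq> G}) \<le> N (dim W)"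
proof -
  have "card {G \<in> \<G>. W \<subseteq> G} \<le> card {H \<in> subspaces_of_dim scale k. W \<subseteq> H}"
    using assms by (intro card_mono) auto
  then show ?thesis using card_star[OF assms(2,3)] by linarith
qed

text \<open>Induction downwards from dimension m, where the full star is the bound. Below m,
  \<open>uncov\<close> supplies an \<open>F\<close> to branch on: the branches take half of the
  bound by \<open>N_Suc_le\<close>, the exceptions the other half by \<open>N_ge\<close>.\<close>

lemma card_substar_le_power:
  assumes G: "\<G> \<subseteq> subspaces_of_dim scale k"
    and uncov: "\<And>W. subspace W \<Longrightarrow> t \<le> dim W \<Longrightarrow> dim W < m \<Longrightarrow>
      \<exists>F\<in>subspaces_of_dim scale k. dim (F \<inter> W) < t \<and> card (deficient scale \<G> F t) \<le> s"
    and "m \<le> k" "subspace W" "t \<le> dim W" "dim W \<le> m"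
  shows "real (card {G \<in> \<G>. W \<subseteq> G}) \<le> v ^ (m - dim W) * N (dim W)"
  using assms(4-)
proof (induction "m - dim W" arbitrary: W)
  case 0
  then show ?case using card_substar_le[OF G, of W] \<open>m \<le> k\<close> by simp
next
  case (Suc a)
  let ?i = "dim W"
  have i: "?i < m" "?i < k" using Suc.hyps(2) \<open>m \<le> k\<close> by linarith+
  obtain F where F: "F \<in> subspaces_of_dim scale k" "dim (F \<inter> W) < t" "card (deficient scale \<G> F t) \<le> s"
    using uncov Suc.prems i by blast
  have "real (card {G \<in> \<G>. W1 \<subseteq> G}) \<le> v ^ a * N (Suc ?i)"
    if "subspace W1" "dim W1 = Suc ?i" for W1
    using Suc.hyps(1)[of W1] Suc.hyps(2) Suc.prems that i by (simp add: Suc_diff_Suc[symmetric])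
  then have "real (card {G \<in> \<G>. W \<subseteq> G}) \<le> real s + real q ^ k * (v ^ a * N (Suc ?i))"
    using F Suc.prems(1) v_pos N_nonneg by (intro card_star_branch[OF G, unfolded CARD_eq_q]) auto
  also have "real q ^ k * (v ^ a * N (Suc ?i)) = v ^ a * (real q ^ k * N (Suc ?i))" by simp
  also have "\<dots> \<le> v ^ a * (v / 2 * N ?i)"
    using v_pos by (intro mult_left_mono N_Suc_le i) auto
  also have "\<dots> = v ^ (m - ?i) * N ?i / 2" by (simp flip: Suc.hyps(2))
  also have "real s \<le> v ^ (m - ?i) * N ?i / 2" using N_ge[of ?i "m - ?i"] i \<open>m \<le> k\<close> by (simp add: diff_le_mono)
  finally show ?case by (simp add: mult.commute)
qed

text \<open>Apart from s exceptions, each member contains one of the at most q^(2tb) t-spaces of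
  \<open>W\<close>. The exceptions turn the factor 1 into 3/2.\<close>

lemma card_le_cover:
  assumes G: "\<G> \<subseteq> subspaces_of_dim scale k"
    and W: "subspace W" "dim W = t + b" "card (deficient scale \<G> W t) \<le> s"
    and T: "\<And>T. subspace T \<Longrightarrow> dim T = t \<Longrightarrow> real (card {G \<in> \<G>. T \<subseteq> G}) \<le> v ^ a * N t"
    and a: "a \<le> k - t"
  shows "real (card \<G>) \<le> 3 / 2 * (real q ^ (2 * t)) ^ b * v ^ a * N t"
proof -
  let ?X = "between t {0} W"
  have "\<G> \<subseteq> deficient scale \<G> W t \<union> (\<Union>T\<in>?X. {G \<in> \<G>. T \<subseteq> G})"
  proof
    fix G assume *: "G \<in> \<G>"
    then have sG: "subspace G" using G subspaces_of_dim_iff by auto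
    show "G \<in> deficient scale \<G> W t \<union> (\<Union>T\<in>?X. {G \<in> \<G>. T \<subseteq> G})"
    proof (cases "dim (G \<inter> W) < t")
      case True
      then show ?thesis using * by (simp add: deficient_def)
    next
      case False
      then obtain T where "subspace T" "dim T = t" "T \<subseteq> G \<inter> W"
        using subspace_of_dim_exists[of "G \<inter> W" t] subspace_inter sG W(1) by auto
      then show ?thesis using * subspace_0 by (auto simp: between_def subspaces_of_dim_iff)
    qed
  qed
  then have "card \<G> \<le> card (deficient scale \<G> W t \<union> (\<Union>T\<in>?X. {G \<in> \<G>. T \<subseteq> G}))"
    by (intro card_mono) auto
  also have "\<dots> \<le> card (deficient scale \<G> W t) + card (\<Union>T\<in>?X. {G \<in> \<G>. T \<subseteq> G})" by (rule card_Un_le)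
  also have "\<dots> \<le> s + (\<Sum>T\<in>?X. card {G \<in> \<G>. T \<subseteq> G})"
    by (intro add_mono W card_UN_le) simp
  finally have "real (card \<G>) \<le> real (s + (\<Sum>T\<in>?X. card {G \<in> \<G>. T \<subseteq> G}))"
    by (simp only: of_nat_le_iff)
  also have "\<dots> = real s + (\<Sum>T\<in>?X. real (card {G \<in> \<G>. T \<subseteq> G}))" by simp
  also have "(\<Sum>T\<in>?X. real (card {G \<in> \<G>. T \<subseteq> G})) \<le> (\<Sum>T\<in>?X. v ^ a * N t)"
    by (intro sum_mono T) (auto simp: between_def subspaces_of_dim_iff)
  also have "\<dots> = real (card ?X) * (v ^ a * N t)" by simp
  also have "\<dots> \<le> (real q ^ (2 * t)) ^ b * (v ^ a * N t)"
  proof (rule mult_right_mono)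
    have "real (card ?X) = gauss_binomial q (b + t) t"
      using card_between[of "{0}" W t, unfolded CARD_eq_q] W subspace_0[OF W(1)] by (simp add: add.commute)
    also have "\<dots> \<le> real q ^ (2 * t * b)" by (rule gauss_binomial_le_power[OF q_ge_2_nat])
    finally show "real (card ?X) \<le> (real q ^ (2 * t)) ^ b" by (simp add: power_mult)
  qed (use v_pos N_nonneg in auto)
  also have "real s \<le> 1 / 2 * ((real q ^ (2 * t)) ^ b * (v ^ a * N t))"
  proof -
    have "2 * real s \<le> v ^ a * N t" using N_ge[of t a] a t_less_k by simp
    moreover have "1 * (v ^ a * N t) \<le> (real q ^ (2 * t)) ^ b * (v ^ a * N t)"
      using v_pos N_nonneg q_ge_2 by (intro mult_right_mono) auto
    ultimately show ?thesis by linarith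
  qed
  finally show ?thesis by (simp add: algebra_simps)
qed

text \<open>Tolerating \<open>s\<close> exceptions makes every member of the other family a candidate for \<open>W\<close>, so
  that the cover number is at most \<open>k\<close>.  Without the bound \<open>t \<le> m\<close> a family with at most \<open>s\<close> members
  would have cover number \<open>0\<close>.\<close>

definition cover_number :: "'b set set \<Rightarrow> nat" where
  "cover_number \<F> = (LEAST m. t \<le> m \<and> (\<exists>W. subspace W \<and> dim W = m \<and> card (deficient scale \<F> W t) \<le> s))"

lemma cover_number:
  assumes "G \<in> subspaces_of_dim scale k" "card (deficient scale \<F> G t) \<le> s"
  shows "t \<le> cover_number \<F>" "cover_number \<F> \<le> k"
    "\<exists>W. subspace W \<and> dim W = cover_number \<F> \<and> card (deficient scale \<F> W t) \<le> s"
    "\<And>W. subspace W \<Longrightarrow> t \<le> dim W \<Longrightarrow> dim W < cover_number \<F> \<Longrightarrow> \<exists>F\<in>\<F>. dim (F \<inter> W) < t"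
proof -
  let ?P = "\<lambda>m. t \<le> m \<and> (\<exists>W. subspace W \<and> dim W = m \<and> card (deficient scale \<F> W t) \<le> s)"
  have "subspace G" "dim G = k" using assms(1) by (simp_all add: subspaces_of_dim_iff)
  then have P: "?P k" using assms(2) t_less_k less_imp_le by blast
  have "?P (cover_number \<F>)" unfolding cover_number_def by (rule LeastI[of ?P, OF P])
  then show "t \<le> cover_number \<F>" "\<exists>W. subspace W \<and> dim W = cover_number \<F> \<and> card (deficient scale \<F> W t) \<le> s"
    by blast+
  show "cover_number \<F> \<le> k" unfolding cover_number_def by (rule Least_le[of ?P, OF P])
  fix W assume W: "subspace W" "t \<le> dim W" "dim W < cover_number \<F>"
  have "\<not> ?P (dim W)" by (rule not_less_Least) (use W(3) in \<open>simp add: cover_number_def\<close>)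
  then have "\<not> card (deficient scale \<F> W t) \<le> s" using W by blast
  \<comment> \<open>Of the more than s deficient members only one is kept.\<close>
  then have "deficient scale \<F> W t \<noteq> {}" by (metis card.empty zero_le)
  then show "\<exists>F\<in>\<F>. dim (F \<inter> W) < t" by (auto simp: deficient_def)
qed

text \<open>The exponents come from different families: a least cover of \<open>\<G>\<close> limits
  the number of t-spaces, while a space below the cover number of \<open>\<F>\<close> leaves some
  \<open>F'\<close> in \<open>\<F>\<close> to branch on, which thins the stars in
  \<open>\<G>\<close>.\<close>

lemma card_le_cover_numbers:
  assumes "\<F> \<subseteq> subspaces_of_dim scale k" "\<G> \<subseteq> subspaces_of_dim scale k"
    and "almost_cross_intersecting scale s t \<F> \<G>" "\<F> \<noteq> {}" "\<G> \<noteq> {}"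
  shows "real (card \<G>) \<le>
    3 / 2 * (real q ^ (2 * t)) ^ (cover_number \<G> - t) * v ^ (cover_number \<F> - t) * N t"
proof -
  obtain F0 G0 where F0: "F0 \<in> \<F>" and G0: "G0 \<in> \<G>" using assms by blast
  note F = cover_number[of G0 \<F>] and G = cover_number[of F0 \<G>]
  have hyps: "G0 \<in> subspaces_of_dim scale k" "card (deficient scale \<F> G0 t) \<le> s"
    "F0 \<in> subspaces_of_dim scale k" "card (deficient scale \<G> F0 t) \<le> s"
    using F0 G0 assms by (auto simp: almost_cross_intersecting_def)
  obtain W where W: "subspace W" "dim W = cover_number \<G>" "card (deficient scale \<G> W t) \<le> s"
    using G hyps by blast
  show ?thesis
  proof (rule card_le_cover[OF assms(2) W(1) _ W(3)])
    show "dim W = t + (cover_number \<G> - t)" using W G hyps by simp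
    show "cover_number \<F> - t \<le> k - t" using F hyps by simp
    fix T assume T: "subspace T" "dim T = t"
    have "real (card {G \<in> \<G>. T \<subseteq> G}) \<le> v ^ (cover_number \<F> - dim T) * N (dim T)"
    proof (rule card_substar_le_power[OF assms(2)])
      fix W' assume "subspace W'" "t \<le> dim W'" "dim W' < cover_number \<F>"
      then obtain F' where "F' \<in> \<F>" "dim (F' \<inter> W') < t" using F(4) hyps by blast
      then show "\<exists>F\<in>subspaces_of_dim scale k. dim (F \<inter> W') < t \<and> card (deficient scale \<G> F t) \<le> s"
        using assms by (auto simp: almost_cross_intersecting_def)
    qed (use T F hyps in auto)
    then show "real (card {G \<in> \<G>. T \<subseteq> G}) \<le> v ^ (cover_number \<F> - t) * N t" using T by simp
  qed
qed

section \<open>Families almost covered by a t-space\<close>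

lemma card_le_star:
  assumes "\<F> \<subseteq> subspaces_of_dim scale k" "subspace W" "dim W = t" "card (deficient scale \<F> W t) \<le> s"
  shows "real (card \<F>) \<le> 3 / 2 * N t"
proof -
  have "real (card {G \<in> \<F>. T \<subseteq> G}) \<le> v ^ 0 * N t" if "subspace T" "dim T = t" for T
    using card_substar_le[OF assms(1), of T] that t_less_k by simp
  then have "real (card \<F>) \<le> 3 / 2 * (real q ^ (2 * t)) ^ 0 * v ^ 0 * N t"
    using assms(3) by (intro card_le_cover[OF assms(1,2) _ assms(4)]) auto
  then show ?thesis by simp
qed

text \<open>Since \<open>F\<close> does not contain \<open>W\<close>, one branching step bounds the
  star of \<open>W\<close> in \<open>\<G>\<close> by s + (v/2) N t. Adding s exceptions, 2s <= v N t
  and v <= 1/7 give (3/2)(1/7) = 3/14.\<close>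

lemma card_le_if_not_subset:
  assumes F: "F \<in> subspaces_of_dim scale k" "card (deficient scale \<G> F t) \<le> s" "\<not> W \<subseteq> F"
    and G: "\<G> \<subseteq> subspaces_of_dim scale k"
    and W: "subspace W" "dim W = t" "card (deficient scale \<G> W t) \<le> s"
  shows "real (card \<G>) \<le> 3 / 14 * N t"
proof -
  have "dim (F \<inter> W) < t" 
    using dim_Int_less_iff[OF W(1,2), of F] F by (simp add: subspaces_of_dim_iff)
  then have "real (card {G \<in> \<G>. W \<subseteq> G}) \<le> real s + real q ^ k * N (Suc t)"
  proof (intro card_star_branch[OF G F(1) _ F(2) W(1), unfolded CARD_eq_q] N_nonneg)
    fix W1 assume "subspace W1" "dim W1 = Suc (dim W)"
    then show "real (card {G \<in> \<G>. W1 \<subseteq> G}) \<le> N (Suc t)"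
      using card_substar_le[OF G, of W1] W(2) t_less_k by simp
  qed
  also have "\<dots> \<le> real s + v / 2 * N t" using N_Suc_le t_less_k by simp
  finally have 1: "real (card {G \<in> \<G>. W \<subseteq> G}) \<le> real s + v / 2 * N t" .
  have "\<G> \<subseteq> deficient scale \<G> W t \<union> {G \<in> \<G>. W \<subseteq> G}"
  proof
    fix G assume *: "G \<in> \<G>"
    then have "subspace G" using G subspaces_of_dim_iff by auto
    then show "G \<in> deficient scale \<G> W t \<union> {G \<in> \<G>. W \<subseteq> G}"
      using * dim_Int_less_iff[OF W(1,2)] by (simp add: deficient_def)
  qed
  then have "card \<G> \<le> card (deficient scale \<G> W t \<union> {G \<in> \<G>. W \<subseteq> G})" by (intro card_mono) auto
  also have "\<dots> \<le> card (deficient scale \<G> W t) + card {G \<in> \<G>. W \<subseteq> G}" by (rule card_Un_le)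
  also have "\<dots> \<le> s + card {G \<in> \<G>. W \<subseteq> G}" using W by simp
  finally have "real (card \<G>) \<le> real s + (real s + v / 2 * N t)" using 1 by linarith
  moreover have "2 * real s \<le> v * N t" using N_ge[of t 1] t_less_k by simp
  moreover have "v * N t \<le> 1 / 7 * N t" using v_le N_nonneg by (intro mult_right_mono) auto
  ultimately show ?thesis by simp
qed

text \<open>The roles cross: \<open>E\<close> almost covers \<open>\<F>\<close> but lies in all
  members of \<open>\<G>\<close>, since a member of \<open>\<G>\<close> not containing
  \<open>E\<close> would make \<open>\<F>\<close> small; likewise for \<open>E'\<close>. The
  deficiency bound for \<open>E\<close> is kept to identify the two spaces later.\<close>

lemma card_product_less_or_stars:
  assumes F: "\<F> \<subseteq> subspaces_of_dim scale k" and G: "\<G> \<subseteq> subspaces_of_dim scale k"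
    and cross: "almost_cross_intersecting scale s t \<F> \<G>" and ne: "\<F> \<noteq> {}" "\<G> \<noteq> {}"
  shows "real (card \<F>) * real (card \<G>) < (N t)\<^sup>2 \<or>
    (\<exists>E\<in>subspaces_of_dim scale t. \<exists>E'\<in>subspaces_of_dim scale t.
       card (deficient scale \<F> E t) \<le> s \<and> (\<forall>F\<in>\<F>. E' \<subseteq> F) \<and> (\<forall>G\<in>\<G>. E \<subseteq> G))"
proof -
  define a b where "a = cover_number \<F> - t" and "b = cover_number \<G> - t"
  have cross': "almost_cross_intersecting scale s t \<G> \<F>"
    using cross by (auto simp: almost_cross_intersecting_def)
  obtain F0 G0 where F0: "F0 \<in> \<F>" and G0: "G0 \<in> \<G>" using ne by blast
  have hyps: "G0 \<in> subspaces_of_dim scale k" "card (deficient scale \<F> G0 t) \<le> s"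
    "F0 \<in> subspaces_of_dim scale k" "card (deficient scale \<G> F0 t) \<le> s"
    using F0 G0 F G cross by (auto simp: almost_cross_intersecting_def)
  have N2: "(N t)\<^sup>2 > 0" using N_t_pos by simp
  show ?thesis
  proof (cases "a + b = 0")
    case False
    let ?A = "real q ^ (2 * t)"
    have A: "?A > 0" using q_ge_2 by simp
    have vA: "v * ?A = 1 / 7" using A by (simp add: v_def)
    have "real (card \<F>) * real (card \<G>) \<le> (3 / 2 * ?A ^ a * v ^ b * N t) * (3 / 2 * ?A ^ b * v ^ a * N t)"
      unfolding a_def b_def
      by (intro mult_mono card_le_cover_numbers[OF F G cross ne] card_le_cover_numbers[OF G F cross' ne(2,1)])
        (use v_pos N_nonneg A in auto)
    also have "\<dots> = 9 / 4 * ((v * ?A) ^ (a + b)) * (N t)\<^sup>2"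
      by (simp add: power_add power_mult_distrib power2_eq_square mult_ac)
    also have "\<dots> \<le> 9 / 4 * (1 / 7) * (N t)\<^sup>2"
    proof -
      have "(1 / 7 :: real) ^ (a + b) \<le> (1 / 7) ^ 1" using False by (intro power_decreasing) auto
      then show ?thesis unfolding vA by (intro mult_right_mono) auto
    qed
    also have "\<dots> < (N t)\<^sup>2" using N2 by simp
    finally show ?thesis by simp
  next
    case True
    then have "cover_number \<F> = t" "cover_number \<G> = t"
      using cover_number(1)[OF hyps(1,2)] cover_number(1)[OF hyps(3,4)] by (auto simp: a_def b_def)
    then obtain E E' where E: "subspace E" "dim E = t" "card (deficient scale \<F> E t) \<le> s"
      and E': "subspace E'" "dim E' = t" "card (deficient scale \<G> E' t) \<le> s"
      using cover_number(3)[OF hyps(1,2)] cover_number(3)[OF hyps(3,4)] by metis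
    \<comment> \<open>One size has the factor 3/2, the other 3/14, and 9/28 < 1.\<close>
    have small: "x * y < (N t)\<^sup>2" if "x \<le> 3 / 2 * N t" "y \<le> 3 / 14 * N t" "0 \<le> y" for x y
    proof -
      have "x * y \<le> (3 / 2 * N t) * (3 / 14 * N t)" using that N_nonneg by (intro mult_mono) auto
      also have "\<dots> < (N t)\<^sup>2" using N2 by (simp add: power2_eq_square)
      finally show ?thesis .
    qed
    consider F1 where "F1 \<in> \<F>" "\<not> E' \<subseteq> F1" | G1 where "G1 \<in> \<G>" "\<not> E \<subseteq> G1"
      | "\<forall>F\<in>\<F>. E' \<subseteq> F" "\<forall>G\<in>\<G>. E \<subseteq> G" by blast
    then show ?thesis
    proof cases
      case 1
      then have "real (card \<G>) \<le> 3 / 14 * N t"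
        using F cross by (intro card_le_if_not_subset[OF _ _ _ G E']) (auto simp: almost_cross_intersecting_def)
      then show ?thesis using small[OF card_le_star[OF F E]] by simp
    next
      case 2
      then have "real (card \<F>) \<le> 3 / 14 * N t"
        using G cross by (intro card_le_if_not_subset[OF _ _ _ F E]) (auto simp: almost_cross_intersecting_def)
      then show ?thesis using small[OF card_le_star[OF G E']] by (simp add: mult.commute)
    next
      case 3
      moreover have "E \<in> subspaces_of_dim scale t" "E' \<in> subspaces_of_dim scale t"
        using E E' by (simp_all add: subspaces_of_dim_iff)
      ultimately show ?thesis using E(3) by blast
    qed
  qed
qed

text \<open>If the spaces differed, the members of the star of \<open>E'\<close> through
  \<open>E\<close> would contain a common (t+1)-space. Then N t <= s + N (t+1), although each
  summand is at most N t / 14.\<close>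

lemma star_almost_through_eq:
  assumes "subspace E" "dim E = t" "subspace E'" "dim E' = t"
    and "card (deficient scale {H \<in> subspaces_of_dim scale k. E' \<subseteq> H} E t) \<le> s"
  shows "E = E'"
proof (rule ccontr)
  assume "E \<noteq> E'"
  let ?S = "{H \<in> subspaces_of_dim scale k. E' \<subseteq> H}"
  have "\<not> E \<subseteq> E'" using subspace_dim_equal[of E E'] assms \<open>E \<noteq> E'\<close> by auto
  then obtain y where y: "y \<in> E" "y \<notin> E'" by blast
  let ?Y = "span (insert y E')"
  have d: "dim ?Y = Suc t" using dim_span_insert assms y by simp
  have "?S \<subseteq> deficient scale ?S E t \<union> {H \<in> subspaces_of_dim scale k. ?Y \<subseteq> H}"
  proof
    fix H assume H: "H \<in> ?S"
    then have sH: "subspace H" by (simp add: subspaces_of_dim_iff)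
    have "?Y \<subseteq> H" if "E \<subseteq> H" using that H y sH by (intro span_minimal) auto
    then show "H \<in> deficient scale ?S E t \<union> {H \<in> subspaces_of_dim scale k. ?Y \<subseteq> H}"
      using H dim_Int_less_iff[OF assms(1,2) sH] by (auto simp: deficient_def)
  qed
  then have "card ?S \<le> card (deficient scale ?S E t \<union> {H \<in> subspaces_of_dim scale k. ?Y \<subseteq> H})"
    by (intro card_mono) auto
  also have "\<dots> \<le> card (deficient scale ?S E t) + card {H \<in> subspaces_of_dim scale k. ?Y \<subseteq> H}"
    by (rule card_Un_le)
  finally have "real (card ?S) \<le> real s + real (card {H \<in> subspaces_of_dim scale k. ?Y \<subseteq> H})"
    using assms(5) by linarith
  then have "N t \<le> real s + N (Suc t)"
    using card_star[of E'] card_star[of ?Y] assms d t_less_k by simp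
  moreover have "2 * real s \<le> v * N t" using N_ge[of t 1] t_less_k by simp
  moreover have "N (Suc t) \<le> v / 2 * N t"
  proof -
    have "1 * N (Suc t) \<le> real q ^ k * N (Suc t)" using N_nonneg q_ge_2 by (intro mult_right_mono) auto
    then show ?thesis using N_Suc_le[OF t_less_k] by simp
  qed
  moreover have "v * N t \<le> 1 / 7 * N t" using v_le N_nonneg by (intro mult_right_mono) auto
  ultimately show False using N_t_pos by simp
qed

section \<open>The bound and the case of equality\<close>

theorem almost_cross_intersecting_bound:
  assumes F: "\<F> \<subseteq> subspaces_of_dim scale k" and G: "\<G> \<subseteq> subspaces_of_dim scale k"
    and cross: "almost_cross_intersecting scale s t \<F> \<G>"
  shows "real (card \<F>) * real (card \<G>) \<le> (N t)\<^sup>2"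
    "real (card \<F>) * real (card \<G>) = (N t)\<^sup>2 \<longleftrightarrow>
      (\<exists>E \<in> subspaces_of_dim scale t.
         \<F> = {H \<in> subspaces_of_dim scale k. E \<subseteq> H} \<and>
         \<G> = {H \<in> subspaces_of_dim scale k. E \<subseteq> H})"
proof -
  let ?st = "\<lambda>E. {H \<in> subspaces_of_dim scale k. E \<subseteq> H}"
  have star: "real (card (?st E)) = N t" if "E \<in> subspaces_of_dim scale t" for E
    using that card_star[of E] t_less_k by (auto simp: subspaces_of_dim_iff)
  have *: "real (card \<F>) * real (card \<G>) \<le> (N t)\<^sup>2 \<and>
    (real (card \<F>) * real (card \<G>) = (N t)\<^sup>2 \<longrightarrow> (\<exists>E \<in> subspaces_of_dim scale t. \<F> = ?st E \<and> \<G> = ?st E))"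
  proof (cases "real (card \<F>) * real (card \<G>) < (N t)\<^sup>2")
    case True
    then show ?thesis by simp
  next
    case False
    have "\<F> \<noteq> {}" "\<G> \<noteq> {}" using False N_t_pos by auto
    then obtain E E' where E: "E \<in> subspaces_of_dim scale t" and E': "E' \<in> subspaces_of_dim scale t"
      and d: "card (deficient scale \<F> E t) \<le> s" and sub: "\<F> \<subseteq> ?st E'" "\<G> \<subseteq> ?st E"
      using card_product_less_or_stars[OF F G cross] False F G by blast
    have cF: "card \<F> \<le> card (?st E')" and cG: "card \<G> \<le> card (?st E)"
      using sub by (auto intro!: card_mono)
    then have le: "real (card \<F>) \<le> N t" "real (card \<G>) \<le> N t" using star[OF E] star[OF E'] by linarith+
    have bound: "real (card \<F>) * real (card \<G>) \<le> (N t)\<^sup>2"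
      unfolding power2_eq_square using le N_nonneg by (intro mult_mono) auto
    \<comment> \<open>Neither size exceeds \<open>N t\<close>, so a product of at least its square
      forces both families to be full stars.\<close>
    have "real (card \<F>) * real (card \<G>) \<ge> N t * N t" using False by (simp add: power2_eq_square)
    moreover have "real (card \<F>) * real (card \<G>) \<le> real (card \<F>) * N t"
      "real (card \<F>) * real (card \<G>) \<le> N t * real (card \<G>)"
      using le by (auto intro: mult_left_mono mult_right_mono)
    ultimately have "N t * N t \<le> real (card \<F>) * N t" "N t * N t \<le> N t * real (card \<G>)" by linarith+
    then have "N t \<le> real (card \<F>)" "N t \<le> real (card \<G>)" using N_t_pos by auto
    then have "card (?st E') \<le> card \<F>" "card (?st E) \<le> card \<G>"
      using star[OF E] star[OF E'] by linarith+
    then have eq: "\<F> = ?st E'" "\<G> = ?st E"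
      using card_seteq[OF _ sub(1)] card_seteq[OF _ sub(2)] by simp_all
    then have "E = E'" using star_almost_through_eq[of E E'] d E E' by (auto simp: subspaces_of_dim_iff)
    then show ?thesis using bound eq E by blast
  qed
  then show "real (card \<F>) * real (card \<G>) \<le> (N t)\<^sup>2" by simp
  show "real (card \<F>) * real (card \<G>) = (N t)\<^sup>2 \<longleftrightarrow>
      (\<exists>E \<in> subspaces_of_dim scale t. \<F> = ?st E \<and> \<G> = ?st E)"
  proof
    assume "\<exists>E \<in> subspaces_of_dim scale t. \<F> = ?st E \<and> \<G> = ?st E"
    then obtain E where "E \<in> subspaces_of_dim scale t" "\<F> = ?st E" "\<G> = ?st E" by blast
    then show "real (card \<F>) * real (card \<G>) = (N t)\<^sup>2"
      using star[of E] by (simp only: power2_eq_square)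
  qed (use * in blast)
qed

end

theorem theorem1p1:
  fixes scale :: "'a::{field,finite} \<Rightarrow> 'b::ab_group_add \<Rightarrow> 'b"
    and q n k t s :: nat
    and \<F> \<G> :: "'b set set"
  assumes "q = CARD('a)"
    and "vector_space scale"
    and "vector_space.dim scale (UNIV :: 'b set) = n"
    and "n > 0" and "k > 0" and "t > 0" and "s > 0"
    and "k \<ge> t + 1"
    and "real n \<ge> 2 * real k + 2 * real t + 1 + log (real q) (7 * real s)"
    and "\<F> \<subseteq> subspaces_of_dim scale k"
    and "\<G> \<subseteq> subspaces_of_dim scale k"
    and "almost_cross_intersecting scale s t \<F> \<G>"
  shows "real (card \<F>) * real (card \<G>) \<le> (gauss_binomial q (n - t) (k - t))\<^sup>2 \<and>
    (real (card \<F>) * real (card \<G>) = (gauss_binomial q (n - t) (k - t))\<^sup>2 \<longleftrightarrow>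
      (\<exists>E \<in> subspaces_of_dim scale t.
         \<F> = {H \<in> subspaces_of_dim scale k. E \<subseteq> H} \<and>
         \<G> = {H \<in> subspaces_of_dim scale k. E \<subseteq> H}))"
proof -
  interpret V: vector_space scale by (rule assms(2))
  obtain B where B: "V.independent B" "UNIV \<subseteq> V.span B" "card B = n"
    using V.basis_exists[of UNIV] assms(3) by blast
  \<comment> \<open>\<open>card\<close> is 0 on infinite sets, so n > 0 makes the basis
    finite.\<close>
  then have finB: "finite B" using \<open>n > 0\<close> card_gt_0_iff by blast
  interpret finite_field_space scale B
    by unfold_locales (use B finB in auto)
  have q: "real q > 1" using CARD_ge_2 assms(1) by linarith
  \<comment> \<open>Nonnegativity makes the natural subtraction defining \<open>c\<close>
    exact.\<close>
  have "log (real q) (7 * real s) \<ge> 0" using q \<open>s > 0\<close> by simp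
  then have n: "2 * k + 2 * t + 1 \<le> n" using assms(9) by linarith
  define c where "c = n - (2 * k + 2 * t + 1)"
  have "log (real q) (7 * real s) \<le> real c" using assms(9) n by (simp add: c_def of_nat_diff)
  then have "7 * real s \<le> real q powr real c" using q \<open>s > 0\<close> by (simp add: log_le_iff)
  then have "real (7 * s) \<le> real (q ^ c)" using q by (simp add: powr_realpow)
  then have "7 * s \<le> q ^ c" by (simp only: of_nat_le_iff)
  then have "7 * s * q ^ (2 * k + 2 * t + 1) \<le> q ^ c * q ^ (2 * k + 2 * t + 1)" by (rule mult_right_mono) simp
  also have "\<dots> = q ^ n" using n by (simp only: c_def le_add_diff_inverse2 flip: power_add)
  finally have "7 * s * q ^ (2 * k + 2 * t + 1) \<le> q ^ n" .
  then interpret large_space scale B q n k t s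
    by unfold_locales (use assms in auto)
  show ?thesis
    using almost_cross_intersecting_bound[OF assms(10-12)] unfolding N_def by (rule conjI)
qed

end
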